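(* Let $X$ be a $T_1$ topological space. Then the following are equivalent: (a) for every sequence $\{f_n\}$ of functions in $C(X)_F$ that converges uniformly on $X$ to a function $f : X \to \mathbb{R}$, the limit function $f$ belongs to $C(X)_F$; (b) the set of non-isolated points of $X$ is finite.
   Context: $C(X)_F$ denotes the ring (under pointwise operations) of all functions $f : X \to \mathbb{R}$ that are continuous except on a finite set, i.e. for which there is a finite subset $F \subseteq X$ such that the restriction $f|_{X\setminus F}$ is continuous on the subspace $X \setminus F$. *)

theory Defs
  imports "HOL-Analysis.Analysis"
begin

text \<open>Functions \<open>X \<rightarrow> \<real>\<close> are represented by total functions of which only the values
  on \<^term>\<open>topspace X\<close> matter: membership does not depend on the values elsewhere.\<close>

definition C_F :: "'a topology \<Rightarrow> ('a \<Rightarrow> real) set" where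
  "C_F X = {f. \<exists>F. finite F \<and> F \<subseteq> topspace X \<and>
      continuous_map (subtopology X (topspace X - F)) euclideanreal f}"

definition isolated_point_of :: "'a topology \<Rightarrow> 'a \<Rightarrow> bool" where
  "isolated_point_of X x \<longleftrightarrow> x \<in> topspace X \<and> openin X {x}"

end

theory Submission
  imports Defs
begin

text \<open>
  If only finitely many points are non-isolated, deleting them leaves a discrete open subspace,
  so every real function on \<open>X\<close> lies in \<^term>\<open>C_F X\<close> and closure under uniform limits is trivial.

  If there are infinitely many, choose distinct non-isolated points \<open>x 0, x 1, \<dots>\<close> and let \<open>g\<close> take
  the value \<open>1 / (k + 1)\<close> at \<open>x k\<close> and \<open>0\<close> elsewhere. Its truncations to \<open>x 0, \<dots>, x (n - 1)\<close>
  vanish off a finite set and converge uniformly to \<open>g\<close>. The nonzero values of \<open>g\<close> are isolated in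
  its range and each is attained exactly once; hence \<open>g\<close>, if continuous off a finite set \<open>F\<close>, would
  make every \<open>x k\<close> outside \<open>F\<close> an isolated point of \<open>topspace X - F\<close>. In a \<open>T\<^sub>1\<close> space the
  complement of \<open>F\<close> is open, so \<open>x k\<close> would be isolated in \<open>X\<close>, a contradiction.
\<close>

lemma mem_C_F_if_finite_nonisolated:
  assumes "finite {x \<in> topspace X. \<not> isolated_point_of X x}"
  shows "g \<in> C_F X"
proof -
  define N where "N = {x \<in> topspace X. \<not> isolated_point_of X x}"
  have "openin (subtopology X (topspace X - N)) U" if "U \<subseteq> topspace X - N" for U
  proof -
    have "openin X (\<Union>x\<in>U. {x})"
      using that by (intro openin_Union) (auto simp: N_def isolated_point_of_def)
    then show ?thesis
      using that by (simp add: subset_openin_subtopology)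
  qed
  then have "continuous_map (subtopology X (topspace X - N)) euclideanreal g"
    by (simp add: continuous_map_def subset_eq)
  then show ?thesis
    using assms unfolding C_F_def N_def by blast
qed

lemma mem_C_F_if_finite_support:
  assumes "finite A" "\<And>y. y \<in> topspace X - A \<Longrightarrow> f y = 0"
  shows "f \<in> C_F X"
proof -
  have "continuous_map (subtopology X (topspace X - topspace X \<inter> A)) euclideanreal f"
    by (rule continuous_map_eq[of _ _ "\<lambda>_. 0"]) (auto simp: assms(2))
  with assms(1) show ?thesis
    unfolding C_F_def by blast
qed

lemma isolated_if_preimage_singleton:
  assumes "t1_space X" "finite F" "F \<subseteq> topspace X"
    and cont: "continuous_map (subtopology X (topspace X - F)) euclideanreal g"
    and "open U" "{y \<in> topspace X - F. g y \<in> U} = {a}"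
  shows "isolated_point_of X a"
proof -
  have "openin (subtopology X (topspace X - F)) {a}"
    using openin_continuous_map_preimage[OF cont, of U] assms(5,6)
    by (simp add: Int_absorb1 Int_commute)
  moreover have "openin X (topspace X - F)"
    using assms(1-3) by (auto simp: t1_space_closedin_finite intro: openin_diff)
  ultimately have "openin X {a}"
    by (rule openin_trans_full)
  then show ?thesis
    using openin_subset unfolding isolated_point_of_def by fastforce
qed

text \<open>For injective \<open>x\<close>, the function with value \<open>1 / (k + 1)\<close> at \<open>x k\<close> and \<open>0\<close> off the range
  of \<open>x\<close>; the index \<open>k\<close> is recovered from the point by inverting \<open>x\<close>.\<close>

definition spikes :: "(nat \<Rightarrow> 'a) \<Rightarrow> 'a \<Rightarrow> real" where
  "spikes x y = (if y \<in> range x then 1 / (real (inv x y) + 1) else 0)"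

lemma spikes_at: "inj x \<Longrightarrow> spikes x (x k) = 1 / (real k + 1)"
  by (simp add: spikes_def)

lemma spikes_uniform_limit:
  assumes "inj x"
  shows "uniform_limit S (\<lambda>n y. if y \<in> x ` {..<n} then spikes x y else 0) (spikes x) sequentially"
proof (rule uniform_limitI)
  fix e :: real assume "0 < e"
  then obtain m where m: "1 / (real m + 1) < e"
    using nat_approx_posE by (metis Suc_eq_plus1 of_nat_1 of_nat_add)
  have "dist (if y \<in> x ` {..<n} then spikes x y else 0) (spikes x y) < e" if "m \<le> n" for n y
  proof (cases "y \<in> range x - x ` {..<n}")
    case True
    then obtain k where k: "y = x k" "n \<le> k" by force
    have "1 / (real k + 1) \<le> 1 / (real m + 1)"
      using k that by (simp add: field_simps)
    then show ?thesis
      using m True k assms by (simp add: spikes_at dist_real_def)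
  next
    case False
    then show ?thesis using \<open>0 < e\<close> by (auto simp: spikes_def)
  qed
  then show "\<forall>\<^sub>F n in sequentially. \<forall>y\<in>S.
      dist (if y \<in> x ` {..<n} then spikes x y else 0) (spikes x y) < e"
    unfolding eventually_sequentially by blast
qed

text \<open>Among the values \<open>1 / (j + 1)\<close>, the interval contains only \<open>1 / (k + 1)\<close>. The right endpoint
  uses \<open>k + 1/2\<close> rather than \<open>k\<close> so that \<open>k = 0\<close> needs no separate treatment.\<close>

lemma spikes_isolated_value:
  assumes "inj x"
  shows "spikes x y \<in> {1 / (real k + 2) <..< 1 / (real k + 1/2)} \<longleftrightarrow> y = x k"
proof
  assume *: "spikes x y \<in> {1 / (real k + 2) <..< 1 / (real k + 1/2)}"
  moreover have "0 < 1 / (real k + 2)" by simp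
  ultimately have "spikes x y \<noteq> 0" by auto
  then obtain j where j: "y = x j"
    by (auto simp: spikes_def split: if_splits)
  have "real j + 1 < real k + 2" "real k + 1/2 < real j + 1"
    using * assms unfolding j by (auto simp: spikes_at field_simps)
  then have "j = k" by linarith
  then show "y = x k" by (simp add: j)
next
  assume "y = x k"
  then show "spikes x y \<in> {1 / (real k + 2) <..< 1 / (real k + 1/2)}"
    using assms by (simp add: spikes_at field_simps)
qed

lemma spikes_notin_C_F:
  assumes "t1_space X" "inj x"
    and x: "\<And>k. x k \<in> topspace X" "\<And>k. \<not> isolated_point_of X (x k)"
  shows "spikes x \<notin> C_F X"
proof
  assume "spikes x \<in> C_F X"
  then obtain F where F: "finite F" "F \<subseteq> topspace X"
      "continuous_map (subtopology X (topspace X - F)) euclideanreal (spikes x)"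
    unfolding C_F_def by blast
  obtain k where k: "x k \<notin> F"
    using F(1) range_inj_infinite[OF assms(2)] finite_subset[of "range x" F] by blast
  have "{y \<in> topspace X - F. spikes x y \<in> {1 / (real k + 2) <..< 1 / (real k + 1/2)}} = {x k}"
    unfolding spikes_isolated_value[OF assms(2)] using k x(1) by auto
  then have "isolated_point_of X (x k)"
    by (rule isolated_if_preimage_singleton[OF assms(1) F open_greaterThanLessThan])
  with x(2) show False by blast
qed

theorem theorem2p9:
  fixes X :: "'a topology"
  assumes "t1_space X"
  shows "(\<forall>(f :: nat \<Rightarrow> 'a \<Rightarrow> real) (g :: 'a \<Rightarrow> real).
            (\<forall>n. f n \<in> C_F X) \<and> uniform_limit (topspace X) f g sequentially \<longrightarrow> g \<in> C_F X)
      \<longleftrightarrow> finite {x \<in> topspace X. \<not> isolated_point_of X x}"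
  (is "?closed \<longleftrightarrow> finite ?N")
proof
  assume closed: ?closed
  show "finite ?N"
  proof (rule ccontr)
    assume "infinite ?N"
    then obtain x :: "nat \<Rightarrow> 'a" where x: "inj x" "range x \<subseteq> ?N"
      using infinite_countable_subset by blast
    have "(\<lambda>y. if y \<in> x ` {..<n} then spikes x y else 0) \<in> C_F X" for n
      by (rule mem_C_F_if_finite_support[of "x ` {..<n}"]) auto
    then have "spikes x \<in> C_F X"
      by (rule closed[rule_format, OF conjI[OF allI spikes_uniform_limit[OF x(1)]]])
    moreover have "spikes x \<notin> C_F X"
      using x(2) by (intro spikes_notin_C_F[OF assms x(1)]) auto
    ultimately show False by blast
  qed
next
  assume "finite ?N"
  then show ?closed
    using mem_C_F_if_finite_nonisolated by blast
qed

end
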